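(* Let $t$ be an indeterminate. For every integer $n\ge 0$, $$\sum_{k=0}^n t^k \left(Q_k +2(t-1)P_{k+1}\right) =2t^{n+1}P_{n+1},$$ where $P_k$ and $Q_k$ are the $k$th Pell and Pell-Lucas numbers.
   Context: The Pell numbers $P_k$ and Pell-Lucas numbers $Q_k$ ($k\ge 0$) both satisfy $x_{n+2}=2x_{n+1}+x_n$ for $n\ge 0$, with initial values $P_0=0$, $P_1=1$ and $Q_0=Q_1=2$. *)

theory Defs
  imports "HOL-Computational_Algebra.Polynomial"
begin

fun pell :: "nat \<Rightarrow> nat" where
  "pell 0 = 0"
| "pell (Suc 0) = 1"
| "pell (Suc (Suc n)) = 2 * pell (Suc n) + pell n"

fun pell_lucas :: "nat \<Rightarrow> nat" where
  "pell_lucas 0 = 2"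
| "pell_lucas (Suc 0) = 2"
| "pell_lucas (Suc (Suc n)) = 2 * pell_lucas (Suc n) + pell_lucas n"

end

theory Submission
  imports Defs
begin

(* Since Q_k = 2 P_{k+1} - 2 P_k, the k-th summand equals
   2 t^{k+1} P_{k+1} - 2 t^k P_k, and the sum telescopes. *)

lemma pell_lucas_plus_pell: "pell_lucas k + 2 * pell k = 2 * pell (Suc k)"
  \<comment> \<open>Both sides satisfy the Pell recurrence and agree at \<open>k = 0\<close> and
    \<open>k = 1\<close>.\<close>
  by (induction k rule: pell.induct) simp_all

lemma pell_summand_telescope:
  fixes t :: "'a::comm_ring_1"
  shows "t ^ k * (of_nat (pell_lucas k) + 2 * (t - 1) * of_nat (pell (Suc k)))
           = 2 * t ^ Suc k * of_nat (pell (Suc k)) - 2 * t ^ k * of_nat (pell k)"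
proof -
  \<comment> \<open>The relation is additive over \<open>nat\<close>, where subtraction truncates;
    it is solved for Q_k only after the cast into the ring.\<close>
  have "of_nat (pell_lucas k + 2 * pell k) = (of_nat (2 * pell (Suc k)) :: 'a)"
    by (simp only: pell_lucas_plus_pell)
  then have "(of_nat (pell_lucas k) :: 'a) = 2 * of_nat (pell (Suc k)) - 2 * of_nat (pell k)"
    by (simp only: of_nat_add of_nat_mult of_nat_numeral eq_diff_eq)
  then show ?thesis
    by (simp only: power_Suc) (simp only: algebra_simps mult_1_left)
qed

lemma sum_pell_lucas_pell:
  fixes t :: "'a::comm_ring_1"
  shows "(\<Sum>k=0..n. t ^ k * (of_nat (pell_lucas k) + 2 * (t - 1) * of_nat (pell (Suc k))))
           = 2 * t ^ Suc n * of_nat (pell (Suc n))"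
  \<comment> \<open>Telescoping with f(k) = 2 t^k P_k leaves f(n+1) - f(0), and f(0) = 0 because P_0
    = 0.\<close>
  unfolding pell_summand_telescope by (subst sum_Suc_diff) simp_all

theorem mainTheorem4:
  fixes t :: "int poly" and n :: nat
  assumes "t = [:0, 1:]"
  shows "(\<Sum>k=0..n. t ^ k * (of_nat (pell_lucas k) + 2 * (t - 1) * of_nat (pell (k + 1))))
           = 2 * t ^ (n + 1) * of_nat (pell (n + 1))"
  using sum_pell_lucas_pell[of t n] by (simp only: Suc_eq_plus1)

end
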